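(* Every convex subset $\mathcal{C}$ of $\mathcal{B}(n)$ has a partition into exactly $w(\mathcal{C})$ skipless chains.
   Context: $\mathcal{B}(n)$ is the family of all subsets of $[n]=\{1,\dots,n\}$ ordered by inclusion. $\mathcal{C} \subseteq \mathcal{B}(n)$ is convex if $X, Y \in \mathcal{C}$ and $X \subseteq Z \subseteq Y$ imply $Z \in \mathcal{C}$. The width $w(\mathcal{C})$ is the maximum size of an antichain in $\mathcal{C}$. A chain $X_1 \subset X_2 \subset \cdots \subset X_m$ is skipless if $|X_{j+1}| = |X_j| + 1$ for every $j$ (i.e. consecutive elements are covering pairs). Such a partition is called an SD-partition. *)

theory Defs
  imports "HOL-Library.Disjoint_Sets"
begin

definition boolean_lattice :: "nat \<Rightarrow> nat set set" where
  "boolean_lattice n = Pow {1..n}"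

definition convex_family :: "nat \<Rightarrow> nat set set \<Rightarrow> bool" where
  "convex_family n \<C> \<longleftrightarrow> \<C> \<subseteq> boolean_lattice n \<and>
     (\<forall>X\<in>\<C>. \<forall>Y\<in>\<C>. \<forall>Z\<in>boolean_lattice n. X \<subseteq> Z \<and> Z \<subseteq> Y \<longrightarrow> Z \<in> \<C>)"

definition antichain :: "'a set set \<Rightarrow> bool" where
  "antichain \<A> \<longleftrightarrow> (\<forall>X\<in>\<A>. \<forall>Y\<in>\<A>. X \<subseteq> Y \<longrightarrow> X = Y)"

text \<open>Meaningful for finite \<open>\<C>\<close> only: the maximum then ranges over a finite set, which contains
  \<open>0\<close> because the empty family is an antichain.\<close>

definition width :: "'a set set \<Rightarrow> nat" where
  "width \<C> = Max {card \<A> | \<A>. \<A> \<subseteq> \<C> \<and> antichain \<A>}"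

text \<open>The list enumerates the chain in increasing order. For finite sets, \<open>X \<subset> Y\<close> together with
  \<open>card Y = card X + 1\<close> says that \<open>Y\<close> covers \<open>X\<close>. The empty chain is admitted here; it never
  occurs as a block of a partition.\<close>

definition skipless_chain :: "'a set set \<Rightarrow> bool" where
  "skipless_chain K \<longleftrightarrow> (\<exists>Xs. K = set Xs \<and>
     (\<forall>j. Suc j < length Xs \<longrightarrow> Xs ! j \<subset> Xs ! Suc j \<and> card (Xs ! Suc j) = card (Xs ! j) + 1))"

definition SD_partition :: "'a set set \<Rightarrow> 'a set set set \<Rightarrow> bool" where
  "SD_partition \<C> P \<longleftrightarrow> partition_on \<C> P \<and> (\<forall>K\<in>P. skipless_chain K) \<and> card P = width \<C>"

end

theory Submission
  imports Defs Complex_Main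
begin

text \<open>
  Let \<open>N X\<close> be the set of members of the convex family \<open>\<C>\<close> that cover a member of \<open>X\<close>, and let
  \<open>S\<close> be a largest subset of \<open>\<C>\<close> that maximises \<open>|S| - |N S|\<close>. By Hall's theorem \<open>N S\<close> can be
  matched downwards into \<open>S\<close>, and \<open>\<C> - S\<close> upwards into \<open>\<C> - N S\<close>. The special feature of
  Boolean lattices is that the downward matching makes every part \<open>T\<close> of \<open>N (N S)\<close> at most as
  large as the set of its lower covers in \<open>N S\<close>; hence adding \<open>N S\<close> to \<open>S\<close> does not decrease
  the deficiency, so \<open>N S \<subseteq> S\<close>. Thus \<open>S\<close> is an up-set of \<open>\<C>\<close>, its minimal elements form the
  antichain \<open>S - N S\<close>, and the matchings link \<open>\<C>\<close> into \<open>|S - N S|\<close> skipless chains.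
\<close>

section \<open>Hall's marriage theorem\<close>

text \<open>Induction on \<open>card A\<close>. A nonempty proper subset \<open>X\<close> that is
  tight (equality in Hall's condition) is matched on its own, and the rest avoids its values. If no
  such subset exists, any available value can be spent on one element.\<close>

lemma hall_marriage:
  fixes f :: "'a \<Rightarrow> 'b set"
  assumes "finite A" and "\<And>a. a \<in> A \<Longrightarrow> finite (f a)"
    and "\<And>X. X \<subseteq> A \<Longrightarrow> card X \<le> card (\<Union>(f ` X))"
  shows "\<exists>g. inj_on g A \<and> (\<forall>a\<in>A. g a \<in> f a)"
  using assms
proof (induction "card A" arbitrary: A f rule: less_induct)
  case less
  note fin = less.prems(1,2) and hall = less.prems(3)
  show ?case
  proof (cases "\<exists>X. X \<subset> A \<and> X \<noteq> {} \<and> card (\<Union>(f ` X)) = card X")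
    case True
    then obtain X where X: "X \<subset> A" "X \<noteq> {}" "card (\<Union>(f ` X)) = card X" by blast
    have finX: "finite X" using X(1) fin(1) by (auto intro: finite_subset)
    have "\<exists>g. inj_on g X \<and> (\<forall>a\<in>X. g a \<in> f a)"
      using X fin finX hall by (intro less.hyps psubset_card_mono) auto
    then obtain g where g: "inj_on g X" "\<forall>a\<in>X. g a \<in> f a" by blast
    \<comment> \<open>Removing the values of \<open>X\<close> preserves Hall's condition: apply it
      to \<open>Y \<union> X\<close> and subtract the tight equality for \<open>X\<close>.\<close>
    have "\<exists>h. inj_on h (A - X) \<and> (\<forall>a\<in>A - X. h a \<in> f a - \<Union>(f ` X))"
    proof (rule less.hyps)
      show "card (A - X) < card A"
        using X fin(1) by (intro psubset_card_mono) auto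
      show "card Y \<le> card (\<Union>a\<in>Y. f a - \<Union>(f ` X))" if Y: "Y \<subseteq> A - X" for Y
      proof -
        have finY: "finite Y" using Y fin(1) by (auto intro: finite_subset)
        have "card Y + card X = card (Y \<union> X)"
          using Y finX finY by (subst card_Un_disjoint) auto
        also have "\<dots> \<le> card (\<Union>(f ` (Y \<union> X)))"
          using Y X(1) by (intro hall) auto
        also have "\<Union>(f ` (Y \<union> X)) = (\<Union>a\<in>Y. f a - \<Union>(f ` X)) \<union> \<Union>(f ` X)"
          by auto
        also have "card \<dots> \<le> card (\<Union>a\<in>Y. f a - \<Union>(f ` X)) + card X"
          using card_Un_le X(3) by metis
        finally show ?thesis by simp
      qed
    qed (use fin in auto)
    then obtain h where h: "inj_on h (A - X)" "\<forall>a\<in>A - X. h a \<in> f a - \<Union>(f ` X)" by blast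
    let ?k = "\<lambda>a. if a \<in> X then g a else h a"
    have "inj_on ?k A"
    proof (rule inj_onI)
      fix x y assume xy: "x \<in> A" "y \<in> A" "?k x = ?k y"
      have mixed: "g a \<noteq> h b" if "a \<in> X" "b \<in> A - X" for a b using that g h by force
      show "x = y"
        using xy g(1) h(1) mixed[of x y] mixed[of y x]
        by (cases "x \<in> X"; cases "y \<in> X") (auto simp: inj_on_def)
    qed
    moreover have "\<forall>a\<in>A. ?k a \<in> f a" using g h by auto
    ultimately show ?thesis by blast
  next
    case False
    show ?thesis
    proof (cases "A = {}")
      case False
      then obtain a where a: "a \<in> A" by blast
      have "card (f a) \<ge> 1" using hall[of "{a}"] a by simp
      then obtain b where b: "b \<in> f a" by fastforce
      have "\<exists>h. inj_on h (A - {a}) \<and> (\<forall>x\<in>A - {a}. h x \<in> f x - {b})"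
      proof (rule less.hyps)
        show "card (A - {a}) < card A"
          using a fin(1) by (intro psubset_card_mono) auto
        show "card Y \<le> card (\<Union>x\<in>Y. f x - {b})" if Y: "Y \<subseteq> A - {a}" for Y
        proof (cases "Y = {}")
          case False
          have YA: "Y \<subset> A" using Y a by auto
          \<comment> \<open>\<open>Y\<close> is nonempty, proper and not tight, so there is a slack
            of one, which pays for the lost value \<open>b\<close>.\<close>
          have "card Y < card (\<Union>(f ` Y))"
            using hall[of Y] YA False \<open>\<not> (\<exists>X. X \<subset> A \<and> X \<noteq> {} \<and> card (\<Union>(f ` X)) = card X)\<close>
            by (metis le_neq_implies_less psubset_imp_subset)
          also have "card (\<Union>(f ` Y)) \<le> card (\<Union>(f ` Y) - {b}) + 1"
            by (simp add: card_Diff_singleton_if) arith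
          also have "\<Union>(f ` Y) - {b} = (\<Union>x\<in>Y. f x - {b})" by auto
          finally show ?thesis by simp
        qed simp
      qed (use fin in auto)
      then obtain h where h: "inj_on h (A - {a})" "\<forall>x\<in>A - {a}. h x \<in> f x - {b}" by blast
      have "inj_on (h(a := b)) A"
        using h unfolding inj_on_def by (auto split: if_splits)
      moreover have "\<forall>x\<in>A. (h(a := b)) x \<in> f x" using h b by auto
      ultimately show ?thesis by blast
    qed auto
  qed
qed

section \<open>Covers, convexity and counting of lower covers\<close>

definition covered_by :: "'a set \<Rightarrow> 'a set \<Rightarrow> bool" where
  "covered_by x y \<longleftrightarrow> (\<exists>a. a \<notin> x \<and> y = insert a x)"

text \<open>Convexity without reference to \<open>n\<close>. For families inside
  \<open>boolean_lattice n\<close> it agrees with \<open>convex_family\<close>, since every subset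
  of a member lies in the lattice.\<close>

definition order_convex :: "'a set set \<Rightarrow> bool" where
  "order_convex \<C> \<longleftrightarrow> (\<forall>x\<in>\<C>. \<forall>y\<in>\<C>. \<forall>z. x \<subseteq> z \<and> z \<subseteq> y \<longrightarrow> z \<in> \<C>)"

lemma order_convexD:
  "order_convex \<C> \<Longrightarrow> x \<in> \<C> \<Longrightarrow> y \<in> \<C> \<Longrightarrow> x \<subseteq> z \<Longrightarrow> z \<subseteq> y \<Longrightarrow> z \<in> \<C>"
  unfolding order_convex_def by metis

definition upper_covers :: "'a set set \<Rightarrow> 'a set set \<Rightarrow> 'a set set" where
  "upper_covers \<C> X = {y \<in> \<C>. \<exists>x\<in>X. covered_by x y}"

lemma upper_covers_subset: "upper_covers \<C> X \<subseteq> \<C>"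
  by (auto simp: upper_covers_def)

lemma upper_covers_Un: "upper_covers \<C> (X \<union> Y) = upper_covers \<C> X \<union> upper_covers \<C> Y"
  by (auto simp: upper_covers_def)

text \<open>
  Every \<open>y \<in> T\<close> distributes weight 1 evenly over the \<open>z \<in> Z\<close> below it. The injection
  \<open>\<phi>\<close> sends \<open>(r \<union> {a, b}, r \<union> {b})\<close>, where \<open>r = m (r \<union> {b})\<close>, to \<open>(r \<union> {a}, r)\<close>; convexity
  gives the new upper set no more lower covers in \<open>S\<close> than \<open>y\<close> has in \<open>Z\<close>, so each
  element of \<open>Z\<close> receives weight at most 1.
\<close>

lemma card_le_card_lower_covers:
  fixes \<C> S :: "'a set set"
  defines "Z \<equiv> upper_covers \<C> S"
  assumes fin: "finite \<C>" and SC: "S \<subseteq> \<C>"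
    and convex: "order_convex \<C>"
    and inj: "inj_on m Z" and m: "\<And>z. z \<in> Z \<Longrightarrow> m z \<in> S \<and> covered_by (m z) z"
    and T: "T \<subseteq> upper_covers \<C> Z"
  shows "card T \<le> card {z \<in> Z. \<exists>y\<in>T. covered_by z y}"
proof -
  define lower where "lower X y = {x \<in> X. covered_by x y}" for X :: "'a set set" and y
  define ZT where "ZT = {z \<in> Z. \<exists>y\<in>T. covered_by z y}"
  have finS: "finite S" and finZ: "finite Z" and finT: "finite T"
    using fin SC T finite_subset upper_covers_subset unfolding Z_def by metis+
  have finl: "finite (lower S y)" "finite (lower Z y)" for y
    using finS finZ by (auto simp: lower_def)
  have finZT: "finite ZT" using finZ by (simp add: ZT_def)
  \<comment> \<open>Convexity enters here: a set squeezed between a member of \<open>S\<close> and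
    \<open>y\<close> stays in \<open>\<C>\<close>.\<close>
  have ZI: "z \<in> Z" if "s \<in> S" "covered_by s z" "z \<subseteq> y" "y \<in> \<C>" for s z y
  proof -
    have "s \<in> \<C>" "s \<subseteq> z" using that SC by (auto simp: covered_by_def)
    then have "z \<in> \<C>" using order_convexD[OF convex] that by blast
    then show ?thesis using that by (auto simp: Z_def upper_covers_def)
  qed
  have TC: "y \<in> \<C>" if "y \<in> T" for y using that T upper_covers_subset by blast
  \<comment> \<open>With \<open>y = insert a z\<close>, the set \<open>y - (z - s)\<close> is
    \<open>insert a s\<close>, the other set strictly between \<open>s\<close> and \<open>y\<close>.
    It covers \<open>s\<close>, hence lies in \<open>Z\<close>.\<close>
  have lower_le: "card (lower S z) \<le> card (lower Z y)" if zy: "covered_by z y" "y \<in> T" for z y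
  proof (rule card_inj_on_le[where f = "\<lambda>s. y - (z - s)"])
    obtain a where a: "a \<notin> z" "y = insert a z" using zy(1) by (auto simp: covered_by_def)
    have eq: "y - (z - s) = insert a s" if "s \<subseteq> z" for s using a that by auto
    have sub: "s \<subseteq> z" if "s \<in> lower S z" for s
      using that by (auto simp: lower_def covered_by_def)
    show "inj_on (\<lambda>s. y - (z - s)) (lower S z)"
    proof (rule inj_onI)
      fix s t assume st: "s \<in> lower S z" "t \<in> lower S z" "y - (z - s) = y - (z - t)"
      then have "insert a s = insert a t" using eq sub by auto
      then show "s = t" using a(1) sub[OF st(1)] sub[OF st(2)] by (metis insert_ident subsetD)
    qed
    show "(\<lambda>s. y - (z - s)) ` lower S z \<subseteq> lower Z y"
    proof (rule image_subsetI)
      fix s assume s: "s \<in> lower S z"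
      obtain c where c: "c \<notin> s" "z = insert c s" using s by (auto simp: lower_def covered_by_def)
      have "insert a s \<in> Z"
        using s a c TC[OF zy(2)] by (intro ZI[of s _ y]) (auto simp: lower_def covered_by_def)
      moreover have "covered_by (insert a s) y"
        unfolding covered_by_def using a c by (intro exI[of _ c]) auto
      ultimately show "y - (z - s) \<in> lower Z y" using eq[OF sub[OF s]] by (simp add: lower_def)
    qed
  qed (rule finl)
  define \<phi> where "\<phi> = (\<lambda>(y, z). (y - (z - m z), m z))"
  have \<phi>: "\<exists>a b r. \<phi> (y, z) = (insert a r, r) \<and> a \<noteq> b \<and> a \<notin> r \<and> b \<notin> r \<and> y = insert a (insert b r)
      \<and> z = insert b r \<and> m z = r \<and> r \<in> S"
    if yz: "z \<in> lower Z y" for y z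
  proof -
    have zZ: "z \<in> Z" using yz by (simp add: lower_def)
    obtain a where a: "a \<notin> z" "y = insert a z" using yz by (auto simp: lower_def covered_by_def)
    obtain b where b: "b \<notin> m z" "z = insert b (m z)" using m[OF zZ] by (auto simp: covered_by_def)
    have "y - (z - m z) = insert a (m z)" using a b by auto
    moreover have "a \<noteq> b" "a \<notin> m z" using a(1) b(2) by auto
    moreover have "y = insert a (insert b (m z))" using a(2) b(2) by simp
    ultimately show ?thesis using a b m[OF zZ] unfolding \<phi>_def by auto
  qed
  have \<phi>_inj: "inj_on \<phi> (Sigma T (lower Z))"
  proof (rule inj_onI)
    fix p q assume p: "p \<in> Sigma T (lower Z)" and q: "q \<in> Sigma T (lower Z)" and eq: "\<phi> p = \<phi> q"
    obtain y z where pyz: "p = (y, z)" "z \<in> lower Z y" using p by auto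
    obtain y' z' where qyz: "q = (y', z')" "z' \<in> lower Z y'" using q by auto
    have "m z = m z'" using eq by (simp add: pyz qyz \<phi>_def)
    then have zz: "z = z'" using inj pyz qyz by (auto simp: lower_def inj_on_def)
    \<comment> \<open>\<open>z\<close> and the first component of the image are the two middle sets
      between \<open>m z\<close> and \<open>y\<close>; their union recovers
      \<open>y\<close>.\<close>
    have "y = z \<union> fst (\<phi> (y, z))" if yz: "z \<in> lower Z y" for y z
    proof -
      obtain a b r where h: "\<phi> (y, z) = (insert a r, r)" "y = insert a (insert b r)" "z = insert b r"
        using \<phi>[OF yz] by blast
      show ?thesis unfolding h(1) fst_conv unfolding h(2,3) by blast
    qed
    from this[OF pyz(2)] this[OF qyz(2)] have "y = y'" using eq zz unfolding pyz(1) qyz(1) by metis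
    then show "p = q" using zz pyz(1) qyz(1) by simp
  qed
  have \<phi>_mem: "fst (\<phi> (y, z)) \<in> ZT \<and> snd (\<phi> (y, z)) \<in> lower S (fst (\<phi> (y, z))) \<and> covered_by (fst (\<phi> (y, z))) y"
    if yz: "y \<in> T" "z \<in> lower Z y" for y z
  proof -
    obtain a b r where h: "\<phi> (y, z) = (insert a r, r)" "a \<noteq> b" "a \<notin> r" "b \<notin> r"
      "y = insert a (insert b r)" "z = insert b r" "m z = r" "r \<in> S" using \<phi>[OF yz(2)] by blast
    have c1: "covered_by r (insert a r)" using h by (auto simp: covered_by_def)
    have c2: "covered_by (insert a r) y" unfolding covered_by_def using h by (intro exI[of _ b]) auto
    have "insert a r \<in> Z" using ZI[OF h(8) c1 _ TC[OF yz(1)]] h(5) by auto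
    then show ?thesis using h(1,8) c1 c2 yz(1) by (auto simp: ZT_def lower_def)
  qed
  have "real (card T) = (\<Sum>y\<in>T. \<Sum>z\<in>lower Z y. 1 / card (lower Z y))"
  proof -
    have "(\<Sum>z\<in>lower Z y. 1 / real (card (lower Z y))) = 1" if "y \<in> T" for y
    proof -
      \<comment> \<open>This is where \<open>T \<subseteq> upper_covers \<C> Z\<close> matters: an
        element without lower covers in \<open>Z\<close> would distribute weight 0 instead of
        1.\<close>
      have "lower Z y \<noteq> {}" using that T by (auto simp: lower_def upper_covers_def)
      then show ?thesis using finl by simp
    qed
    then show ?thesis by simp
  qed
  also have "\<dots> = (\<Sum>(y, z)\<in>Sigma T (lower Z). 1 / card (lower Z y))"
    using finT finl by (intro sum.Sigma) auto
  also have "\<dots> \<le> (\<Sum>p\<in>Sigma T (lower Z). 1 / card (lower S (fst (\<phi> p))))"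
  proof (rule sum_mono)
    fix p assume "p \<in> Sigma T (lower Z)"
    then obtain y z where p: "p = (y, z)" "y \<in> T" "z \<in> lower Z y" by auto
    note mem = \<phi>_mem[OF p(2,3)]
    \<comment> \<open>Positivity is essential: with \<open>1 / 0 = 0\<close> the comparison of
      reciprocals would fail for an empty set.\<close>
    have "card (lower S (fst (\<phi> p))) > 0"
      using mem finl unfolding p(1) by (auto simp: card_gt_0_iff)
    then show "(case p of (y, z) \<Rightarrow> 1 / real (card (lower Z y))) \<le> 1 / card (lower S (fst (\<phi> p)))"
      using lower_le[of "fst (\<phi> p)" y] mem p by (auto intro!: divide_left_mono)
  qed
  also have "\<dots> = (\<Sum>(z, s)\<in>\<phi> ` Sigma T (lower Z). 1 / card (lower S z))"
    by (subst sum.reindex[OF \<phi>_inj]) (simp add: case_prod_unfold)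
  also have "\<dots> \<le> (\<Sum>(z, s)\<in>Sigma ZT (lower S). 1 / card (lower S z))"
  proof (rule sum_mono2)
    show "finite (Sigma ZT (lower S))" using finZT finl by auto
    show "\<phi> ` Sigma T (lower Z) \<subseteq> Sigma ZT (lower S)"
    proof
      fix p assume "p \<in> \<phi> ` Sigma T (lower Z)"
      then obtain y z where "p = \<phi> (y, z)" "y \<in> T" "z \<in> lower Z y" by blast
      then show "p \<in> Sigma ZT (lower S)" using \<phi>_mem[of y z] by (metis SigmaI prod.collapse)
    qed
  qed auto
  also have "\<dots> = (\<Sum>z\<in>ZT. \<Sum>s\<in>lower S z. 1 / card (lower S z))"
    using finZT finl by (intro sum.Sigma[symmetric]) auto
  also have "\<dots> \<le> (\<Sum>z\<in>ZT. 1)"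
    by (intro sum_mono) simp
  finally show ?thesis by (simp add: ZT_def)
qed

section \<open>Sets of maximum deficiency and their matchings\<close>

text \<open>Take an inclusion-maximal set among the finitely many maximisers. The last clause is
  what later forces the upper covers of \<open>S\<close> into \<open>S\<close>.\<close>

lemma max_deficiency_set_exists:
  fixes \<C> :: "'a set" and N :: "'a set \<Rightarrow> 'b set"
  assumes "finite \<C>"
  obtains S where "S \<subseteq> \<C>"
    and "\<And>X. X \<subseteq> \<C> \<Longrightarrow> int (card X) - int (card (N X)) \<le> int (card S) - int (card (N S))"
    and "\<And>X. X \<subseteq> \<C> \<Longrightarrow> S \<subseteq> X \<Longrightarrow>
      int (card S) - int (card (N S)) \<le> int (card X) - int (card (N X)) \<Longrightarrow> X = S"
proof -
  define d where "d X = int (card X) - int (card (N X))" for X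
  define M where "M = Max (d ` Pow \<C>)"
  have fin: "finite (Pow \<C>)" using assms by simp
  have le: "d X \<le> M" if "X \<subseteq> \<C>" for X
    unfolding M_def using that fin by (intro Max_ge) auto
  have "M \<in> d ` Pow \<C>" unfolding M_def using fin by (intro Max_in) auto
  then have "{X \<in> Pow \<C>. d X = M} \<noteq> {}" by auto
  moreover have "finite {X \<in> Pow \<C>. d X = M}" using fin by simp
  ultimately obtain S where S: "S \<in> {X \<in> Pow \<C>. d X = M}"
    and max: "\<And>X. X \<in> {X \<in> Pow \<C>. d X = M} \<Longrightarrow> S \<subseteq> X \<Longrightarrow> S = X"
    using finite_has_maximal[of "{X \<in> Pow \<C>. d X = M}"] by auto
  show thesis
  proof (rule that)
    show "S \<subseteq> \<C>" using S by simp
    show "int (card X) - int (card (N X)) \<le> int (card S) - int (card (N S))" if "X \<subseteq> \<C>" for X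
      using le[OF that] S by (simp add: d_def)
    show "X = S" if "X \<subseteq> \<C>" "S \<subseteq> X"
      "int (card S) - int (card (N S)) \<le> int (card X) - int (card (N X))" for X
      using le[OF that(1)] S that max[of X] by (simp add: d_def)
  qed
qed

text \<open>Maximum deficiency gives both Hall conditions, by shrinking and by enlarging
  \<open>S\<close>. Closedness follows from inclusion-maximality and
  \<open>card_le_card_lower_covers\<close>.\<close>

lemma closed_family_with_matchings:
  fixes \<C> :: "'a set set"
  assumes fin: "finite \<C>"
    and convex: "order_convex \<C>"
  obtains S m u where "S \<subseteq> \<C>" and "upper_covers \<C> S \<subseteq> S"
    and "inj_on m (upper_covers \<C> S)"
    and "\<forall>z\<in>upper_covers \<C> S. m z \<in> S \<and> covered_by (m z) z"
    and "inj_on u (\<C> - S)"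
    and "\<forall>x\<in>\<C> - S. u x \<in> \<C> - upper_covers \<C> S \<and> covered_by x (u x)"
proof -
  let ?N = "upper_covers \<C>"
  obtain S where SC: "S \<subseteq> \<C>"
    and max: "\<And>X. X \<subseteq> \<C> \<Longrightarrow> int (card X) - int (card (?N X)) \<le> int (card S) - int (card (?N S))"
    and largest: "\<And>X. X \<subseteq> \<C> \<Longrightarrow> S \<subseteq> X \<Longrightarrow>
      int (card S) - int (card (?N S)) \<le> int (card X) - int (card (?N X)) \<Longrightarrow> X = S"
    using max_deficiency_set_exists[OF fin, of ?N] by blast
  have finS: "finite S" using SC fin finite_subset by blast
  have finN: "finite (?N X)" for X using fin upper_covers_subset finite_subset by metis
  have "\<exists>m. inj_on m (?N S) \<and> (\<forall>z\<in>?N S. m z \<in> {s \<in> S. covered_by s z})"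
  proof (rule hall_marriage)
    fix W assume W: "W \<subseteq> ?N S"
    let ?D = "\<Union>z\<in>W. {s \<in> S. covered_by s z}"
    \<comment> \<open>Deleting all lower covers of \<open>W\<close> from \<open>S\<close> costs
      \<open>card ?D\<close> elements but frees at least \<open>card W\<close> upper covers, so
      \<open>card ?D < card W\<close> would raise the deficiency.\<close>
    have "?N (S - ?D) \<subseteq> ?N S - W" by (auto simp: upper_covers_def)
    then have "card (?N (S - ?D)) \<le> card (?N S - W)" using finN by (intro card_mono) auto
    also have "card (?N S - W) = card (?N S) - card W"
      using W finN finite_subset by (intro card_Diff_subset) auto
    finally have 1: "card (?N (S - ?D)) \<le> card (?N S) - card W" .
    have 2: "card W \<le> card (?N S)" using W finN by (intro card_mono) auto
    have 3: "card (S - ?D) = card S - card ?D"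
      using finS by (intro card_Diff_subset) (auto intro: finite_subset)
    have 4: "card ?D \<le> card S" using finS by (intro card_mono) auto
    have "int (card (S - ?D)) - int (card (?N (S - ?D))) \<le> int (card S) - int (card (?N S))"
      using SC by (intro max) auto
    then show "card W \<le> card ?D" using 1 2 3 4 by linarith
  qed (use finN finS in auto)
  then obtain m where m: "inj_on m (?N S)"
    "\<And>z. z \<in> ?N S \<Longrightarrow> m z \<in> S \<and> covered_by (m z) z" by auto
  have "\<exists>u. inj_on u (\<C> - S) \<and> (\<forall>x\<in>\<C> - S. u x \<in> ?N {x} - ?N S)"
  proof (rule hall_marriage)
    fix X assume X: "X \<subseteq> \<C> - S"
    let ?U = "\<Union>x\<in>X. ?N {x} - ?N S"
    have finX: "finite X" using X fin finite_subset by auto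
    \<comment> \<open>Adding \<open>X\<close> to \<open>S\<close> must create at least
      \<open>card X\<close> new upper covers, or the deficiency would rise.\<close>
    have "?N (S \<union> X) = ?N S \<union> ?U" by (auto simp: upper_covers_def)
    then have "card (?N (S \<union> X)) = card (?N S) + card ?U"
      using finN finX by (simp only:) (intro card_Un_disjoint, auto)
    moreover have "card (S \<union> X) = card S + card X"
      using finS finX X by (intro card_Un_disjoint) auto
    moreover have "int (card (S \<union> X)) - int (card (?N (S \<union> X))) \<le> int (card S) - int (card (?N S))"
      using SC X by (intro max) auto
    ultimately show "card X \<le> card ?U" by linarith
  qed (use fin finN in auto)
  then obtain u where u: "inj_on u (\<C> - S)" "\<And>x. x \<in> \<C> - S \<Longrightarrow> u x \<in> ?N {x} - ?N S" by blast
  have "S \<union> ?N S = S"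
  proof (rule largest)
    show "S \<union> ?N S \<subseteq> \<C>" using SC upper_covers_subset by blast
    define T where "T = ?N (?N S) - ?N S"
    have "card T \<le> card {z \<in> ?N S. \<exists>y\<in>T. covered_by z y}"
      by (rule card_le_card_lower_covers[OF fin SC convex m]) (auto simp: T_def)
    \<comment> \<open>A lower cover of some \<open>y \<in> T\<close> cannot lie in \<open>S\<close>,
      as \<open>y\<close> would then be in \<open>?N S\<close>. So \<open>S \<union> ?N S\<close>
      gains at least as many elements as upper covers.\<close>
    also have "\<dots> \<le> card (?N S - S)"
      using finN by (intro card_mono) (auto simp: T_def upper_covers_def)
    finally have "card T \<le> card (?N S - S)" .
    moreover have "card (?N (S \<union> ?N S)) = card (?N S) + card T"
    proof -
      have "?N (S \<union> ?N S) = ?N S \<union> T" unfolding T_def upper_covers_Un by blast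
      then show ?thesis
        using finN by (simp only:) (intro card_Un_disjoint, auto simp: T_def)
    qed
    moreover have "card (S \<union> ?N S) = card S + card (?N S - S)"
      using finS finN by (subst card_Un_disjoint[symmetric]) auto
    ultimately show "int (card S) - int (card (?N S))
        \<le> int (card (S \<union> ?N S)) - int (card (?N (S \<union> ?N S)))" by linarith
  qed simp
  then have "?N S \<subseteq> S" by blast
  with SC m u show thesis by (intro that[of S m u]) (auto simp: upper_covers_def)
qed

section \<open>The antichain of minimal elements\<close>

text \<open>Climb from \<open>x \<in> S\<close> to a larger \<open>y \<in> \<C>\<close> one point at
  a time. Convexity keeps each step in \<open>\<C>\<close> and closedness keeps it in
  \<open>S\<close>, so \<open>y\<close> ends up covering a member of \<open>S\<close>.\<close>

lemma minimal_elements_antichain: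
  fixes \<C> S :: "'a set set"
  assumes fin: "\<forall>x\<in>\<C>. finite x" and SC: "S \<subseteq> \<C>"
    and convex: "order_convex \<C>"
    and closed: "upper_covers \<C> S \<subseteq> S"
  shows "antichain (S - upper_covers \<C> S)"
proof -
  have up: "y \<in> upper_covers \<C> S" if "x \<in> S" "y \<in> \<C>" "x \<subset> y" for x y
    using that
  proof (induction "card (y - x)" arbitrary: x rule: less_induct)
    case less
    obtain a where a: "a \<in> y" "a \<notin> x" using less.prems(3) by blast
    have "insert a x \<in> \<C>"
      using order_convexD[OF convex, of x y "insert a x"] less.prems SC a by auto
    then have N: "insert a x \<in> upper_covers \<C> S"
      using less.prems(1) a by (auto simp: upper_covers_def covered_by_def)
    show ?case
    proof (cases "insert a x = y")
      case False
      have "card (y - insert a x) < card (y - x)"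
        using a bspec[OF fin less.prems(2)] by (intro psubset_card_mono) auto
      then show ?thesis using less.hyps[of "insert a x"] N closed less.prems a False by blast
    qed (use N in simp)
  qed
  show ?thesis unfolding antichain_def using up SC by blast
qed

lemma covered_by_card: "covered_by x y \<Longrightarrow> finite y \<Longrightarrow> x \<subset> y \<and> card y = card x + 1"
  by (auto simp: covered_by_def)

section \<open>From links to skipless chains\<close>

text \<open>\<open>E\<close> has in-degree and out-degree at most one and increases cardinality, so
  it splits \<open>\<C>\<close> into disjoint paths, one for each element without a
  predecessor.\<close>

lemma links_partition:
  fixes \<C> :: "'a set set"
  assumes finC: "finite \<C>" and fin: "\<forall>x\<in>\<C>. finite x"
    and E: "E \<subseteq> {(x, y). x \<in> \<C> \<and> y \<in> \<C> \<and> covered_by x y}"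
    and sv: "single_valued E" and svc: "single_valued (E\<inverse>)"
  obtains P where "partition_on \<C> P" and "\<forall>K\<in>P. skipless_chain K"
    and "card P = card (\<C> - Range E)"
proof -
  define B where "B = \<C> - Range E"
  define K where "K x = E\<^sup>* `` {x}" for x
  have KC: "K x \<subseteq> \<C>" if "x \<in> \<C>" for x
  proof
    fix y assume "y \<in> K x"
    then have "(x, y) \<in> E\<^sup>*" by (simp add: K_def)
    then show "y \<in> \<C>" by (induction rule: rtrancl_induct) (use that E in auto)
  qed
  \<comment> \<open>The bound makes \<open>card (\<Union>\<C>) - card x\<close> strictly decrease
    along links, which drives the induction that lists a path from its start.\<close>
  have bound: "card y \<le> card (\<Union>\<C>)" if "y \<in> \<C>" for y
    using that finC fin by (intro card_mono) auto
  have chain: "\<exists>Xs. Xs \<noteq> [] \<and> hd Xs = x \<and> set Xs = K x \<and>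
      (\<forall>j. Suc j < length Xs \<longrightarrow> Xs ! j \<subset> Xs ! Suc j \<and> card (Xs ! Suc j) = card (Xs ! j) + 1)"
    if "x \<in> \<C>" for x
    using that
  proof (induction "card (\<Union>\<C>) - card x" arbitrary: x rule: less_induct)
    case less
    show ?case
    proof (cases "x \<in> Domain E")
      case False
      then have "K x = {x}" by (auto simp: K_def elim: converse_rtranclE)
      then show ?thesis by (intro exI[of _ "[x]"]) auto
    next
      case True
      then obtain y where xy: "(x, y) \<in> E" by blast
      then have y: "y \<in> \<C>" "covered_by x y" using E by auto
      have cov: "x \<subset> y" "card y = card x + 1" using covered_by_card[OF y(2) bspec[OF fin y(1)]] by auto
      have "card (\<Union>\<C>) - card y < card (\<Union>\<C>) - card x" using cov bound[OF y(1)] by linarith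
      from less.hyps[OF this y(1)] obtain Xs where Xs: "Xs \<noteq> []" "hd Xs = y" "set Xs = K y"
        "\<forall>j. Suc j < length Xs \<longrightarrow> Xs ! j \<subset> Xs ! Suc j \<and> card (Xs ! Suc j) = card (Xs ! j) + 1"
        by blast
      have "K x = insert x (K y)"
      proof
        show "K x \<subseteq> insert x (K y)"
          unfolding K_def using single_valuedD[OF sv xy] by (auto elim: converse_rtranclE)
        show "insert x (K y) \<subseteq> K x"
          unfolding K_def using xy by (auto intro: converse_rtrancl_into_rtrancl)
      qed
      moreover have "(x # Xs) ! j \<subset> (x # Xs) ! Suc j
          \<and> card ((x # Xs) ! Suc j) = card ((x # Xs) ! j) + 1" if "Suc j < length (x # Xs)" for j
        using that Xs cov by (cases j) (auto simp: hd_conv_nth)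
      ultimately show ?thesis using Xs(3) by (intro exI[of _ "x # Xs"]) auto
    qed
  qed
  have start: "\<exists>b\<in>B. y \<in> K b" if "y \<in> \<C>" for y
    using that
  proof (induction "card y" arbitrary: y rule: less_induct)
    case less
    show ?case
    proof (cases "y \<in> Range E")
      case False
      then show ?thesis using less.prems by (auto simp: B_def K_def)
    next
      case True
      then obtain x where xy: "(x, y) \<in> E" by blast
      then have x: "x \<in> \<C>" "covered_by x y" using E by auto
      then have "card x < card y" using covered_by_card fin less.prems by fastforce
      with x(1) obtain b where "b \<in> B" "x \<in> K b" using less.hyps by blast
      then show ?thesis using xy by (auto simp: K_def intro: rtrancl_into_rtrancl)
    qed
  qed
  \<comment> \<open>Walking backwards from \<open>y\<close> is deterministic, so one of
    \<open>b\<close>, \<open>c\<close> is reached from the other; neither has a predecessor.\<close>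
  have eq: "b = c" if "b \<in> B" "c \<in> B" "y \<in> K b" "y \<in> K c" for b c y
  proof -
    have "(y, b) \<in> (E\<inverse>)\<^sup>*" "(y, c) \<in> (E\<inverse>)\<^sup>*"
      using that by (auto simp: K_def rtrancl_converse)
    then have "(b, c) \<in> (E\<inverse>)\<^sup>* \<or> (c, b) \<in> (E\<inverse>)\<^sup>*"
      using svc single_valued_confluent by metis
    then show ?thesis using that(1,2) by (auto simp: B_def elim: converse_rtranclE)
  qed
  have self: "b \<in> K b" for b by (simp add: K_def)
  have inj: "inj_on K B" using eq self by (metis inj_onI)
  show thesis
  proof (rule that[of "K ` B"])
    show "partition_on \<C> (K ` B)"
    proof (rule partition_onI)
      show "\<Union>(K ` B) = \<C>" using start KC by (auto simp: B_def)
      show "disjnt p q" if "p \<in> K ` B" "q \<in> K ` B" "p \<noteq> q" for p q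
        using that eq by (fastforce simp: disjnt_def)
    qed (use self in blast)
    show "\<forall>L\<in>K ` B. skipless_chain L"
    proof
      fix L assume "L \<in> K ` B"
      then obtain b where "b \<in> \<C>" "L = K b" by (auto simp: B_def)
      then show "skipless_chain L" unfolding skipless_chain_def using chain by metis
    qed
    show "card (K ` B) = card (\<C> - Range E)" using card_image[OF inj] by (simp add: B_def)
  qed
qed

section \<open>Chain partitions bound antichains\<close>

lemma skipless_chain_comparable:
  assumes "skipless_chain K" "X \<in> K" "Y \<in> K"
  shows "X \<subseteq> Y \<or> Y \<subseteq> X"
proof -
  obtain Xs where Xs: "K = set Xs"
    "\<And>j. Suc j < length Xs \<Longrightarrow> Xs ! j \<subset> Xs ! Suc j"
    using assms(1) unfolding skipless_chain_def by blast
  have mono: "Xs ! i \<subseteq> Xs ! j" if "i \<le> j" "j < length Xs" for i j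
    using that
  proof (induction j rule: dec_induct)
    case (step k)
    then show ?case using Xs(2)[of k] by auto
  qed simp
  show ?thesis using assms(2,3) mono unfolding Xs(1) in_set_conv_nth by (metis nle_le)
qed

lemma card_antichain_le_card_chain_partition:
  assumes "finite \<C>" "partition_on \<C> P" "\<forall>K\<in>P. skipless_chain K"
    "\<A> \<subseteq> \<C>" "antichain \<A>"
  shows "card \<A> \<le> card P"
proof -
  have "\<forall>X\<in>\<A>. \<exists>K\<in>P. X \<in> K" using assms(2,4) by (auto simp: partition_on_def)
  then obtain f where f: "\<And>X. X \<in> \<A> \<Longrightarrow> f X \<in> P \<and> X \<in> f X" by metis
  have "inj_on f \<A>"
  proof (rule inj_onI)
    fix X Y assume XY: "X \<in> \<A>" "Y \<in> \<A>" "f X = f Y"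
    then have "X \<subseteq> Y \<or> Y \<subseteq> X" using f assms(3) skipless_chain_comparable by metis
    then show "X = Y" using assms(5) XY by (auto simp: antichain_def)
  qed
  moreover have "finite P" using assms(1,2) finite_elements by blast
  ultimately show ?thesis using f by (intro card_inj_on_le[of f]) auto
qed

section \<open>Joining the matchings and computing the width\<close>

theorem theorem10:
  fixes n :: nat and \<C> :: "nat set set"
  assumes "convex_family n \<C>"
  shows "\<exists>P. SD_partition \<C> P"
proof -
  have sub: "\<C> \<subseteq> Pow {1..n}" using assms by (simp add: convex_family_def boolean_lattice_def)
  have finC: "finite \<C>" using sub finite_subset by auto
  have fin: "\<forall>x\<in>\<C>. finite x" using sub finite_subset by blast
  have convex: "order_convex \<C>"
    unfolding order_convex_def
  proof (intro ballI allI impI)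
    fix x y z assume xyz: "x \<in> \<C>" "y \<in> \<C>" "x \<subseteq> z \<and> z \<subseteq> y"
    then have "z \<in> boolean_lattice n" using sub by (auto simp: boolean_lattice_def)
    then show "z \<in> \<C>" using assms xyz unfolding convex_family_def by metis
  qed
  obtain S m u where SC: "S \<subseteq> \<C>" and closed: "upper_covers \<C> S \<subseteq> S"
    and m_inj: "inj_on m (upper_covers \<C> S)"
    and m: "\<forall>z\<in>upper_covers \<C> S. m z \<in> S \<and> covered_by (m z) z"
    and u_inj: "inj_on u (\<C> - S)"
    and u: "\<forall>x\<in>\<C> - S. u x \<in> \<C> - upper_covers \<C> S \<and> covered_by x (u x)"
    by (rule closed_family_with_matchings[OF finC convex])
  define Z where "Z = upper_covers \<C> S"
  \<comment> \<open>The two kinds of links never clash: \<open>u\<close> starts outside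
    \<open>S\<close> and ends outside \<open>Z\<close>, while \<open>m\<close> gives links that
    start in \<open>S\<close> and end in \<open>Z\<close>. Hence \<open>E\<close> is single-valued
    in both directions.\<close>
  define E where "E = (\<lambda>x. (x, u x)) ` (\<C> - S) \<union> (\<lambda>z. (m z, z)) ` Z"
  have ZS: "Z \<subseteq> S" using closed by (simp add: Z_def)
  have anti: "antichain (S - Z)"
    unfolding Z_def by (rule minimal_elements_antichain[OF fin SC convex closed])
  have "E \<subseteq> {(x, y). x \<in> \<C> \<and> y \<in> \<C> \<and> covered_by x y}"
    using m u SC ZS by (auto simp: E_def Z_def)
  moreover have "single_valued E"
    using m m_inj by (auto simp: E_def Z_def single_valued_def inj_on_def)
  moreover have "single_valued (E\<inverse>)"
    using u u_inj by (auto simp: E_def Z_def single_valued_def inj_on_def)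
  ultimately obtain P where P: "partition_on \<C> P" "\<forall>K\<in>P. skipless_chain K"
    "card P = card (\<C> - Range E)"
    by (rule links_partition[OF finC fin])
  have "card P = card (S - Z)"
  proof -
    have finS: "finite S" and finZ: "finite Z" using SC ZS finC finite_subset by metis+
    have R: "Range E = u ` (\<C> - S) \<union> Z" by (auto simp: E_def Range_iff image_iff)
    have RC: "Range E \<subseteq> \<C>" using u ZS SC unfolding R by auto
    have "card (Range E) = card (u ` (\<C> - S)) + card Z"
      unfolding R using u finC finZ by (intro card_Un_disjoint) (auto simp: Z_def)
    also have "card (u ` (\<C> - S)) = card \<C> - card S"
      using card_image[OF u_inj] SC finS by (simp add: card_Diff_subset)
    finally have "card (Range E) = card \<C> - card S + card Z" .
    moreover have "card S \<le> card \<C>" "card Z \<le> card S"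
      using SC ZS finC finS by (auto intro: card_mono)
    moreover have "card (\<C> - Range E) = card \<C> - card (Range E)"
      using RC finC finite_subset by (intro card_Diff_subset) auto
    moreover have "card (S - Z) = card S - card Z"
      using ZS finZ by (simp add: card_Diff_subset)
    ultimately show ?thesis using P(3) by linarith
  qed
  moreover have "width \<C> = card (S - Z)"
    unfolding width_def
  proof (rule Max_eqI)
    show "finite {card \<A> |\<A>. \<A> \<subseteq> \<C> \<and> antichain \<A>}" using finC by simp
    show "card (S - Z) \<in> {card \<A> |\<A>. \<A> \<subseteq> \<C> \<and> antichain \<A>}" using anti SC by blast
    \<comment> \<open>Here \<open>calculation\<close> is \<open>card P = card (S - Z)\<close>, so
      the partition just built bounds every antichain.\<close>
    show "k \<le> card (S - Z)" if "k \<in> {card \<A> |\<A>. \<A> \<subseteq> \<C> \<and> antichain \<A>}" for k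
      using that card_antichain_le_card_chain_partition[OF finC P(1,2)] calculation by auto
  qed
  ultimately have "SD_partition \<C> P" using P(1,2) by (simp add: SD_partition_def)
  then show ?thesis by blast
qed

end
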